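(* Let $A: X\to X$ be a linear operator, $b\in X$, $\beta\ge 0$, and consider the least squares problem of minimizing $$F(x)=|Ax-b|^2+\beta|x|^2 .$$ Fix an index $j\ge 0$, and let $x_{1,j},\dots,x_{m,j}\in X$ be generated by the variable step size update $$x_{i+1,j}=x_{i,j}+\alpha_{i,j}\,p_{i,j},\qquad 1\le i<m,$$ with search directions $p_{i,j}\in X$ and Cauchy step sizes $$\alpha_{i,j}=\frac{(r_{i,j},Ap_{i,j})-\beta\,(x_{i,j},p_{i,j})}{|Ap_{i,j}|^2+\beta|p_{i,j}|^2},\qquad r_{i,j}=b-Ax_{i,j},$$ where the denominators are assumed nonzero. Then the sequence $\{|F(x_{i,j})|^2\}_{i=1}^m$ is monotonically decreasing, i.e. $|F(x_{i+1,j})|^2\le|F(x_{i,j})|^2$ for $1\le i<m$.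
   Context: $X$ is a real Banach space whose norm $|\cdot|$ is induced by an inner product $(\cdot,\cdot)$. The Cauchy step $\alpha_{i,j}$ is the step size minimizing $|A(x_{i,j}+\alpha p_{i,j})-b|^2+\beta|x_{i,j}+\alpha p_{i,j}|^2$ over $\alpha\in\mathbb{R}$. The index $j$ counts outer acceleration rounds and is fixed here. *)

theory Defs
  imports "HOL-Analysis.Analysis"
begin

definition lsq_objective ::
    "('a::real_inner \<Rightarrow> 'a) \<Rightarrow> 'a \<Rightarrow> real \<Rightarrow> 'a \<Rightarrow> real" where
  "lsq_objective A b \<beta> x = (norm (A x - b))\<^sup>2 + \<beta> * (norm x)\<^sup>2"

definition cauchy_step_denom ::
    "('a::real_inner \<Rightarrow> 'a) \<Rightarrow> real \<Rightarrow> 'a \<Rightarrow> real" where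
  "cauchy_step_denom A \<beta> p = (norm (A p))\<^sup>2 + \<beta> * (norm p)\<^sup>2"

text \<open>Closed form, in terms of the residual \<^term>\<open>b - A x\<close>, of the step size
  \<^term>\<open>\<alpha> :: real\<close> minimizing \<^term>\<open>lsq_objective A b \<beta> (x + \<alpha> *\<^sub>R p)\<close>
  for linear \<^term>\<open>A\<close> and nonnegative \<^term>\<open>\<beta>\<close>; meaningful only if the
  denominator is nonzero.\<close>

definition cauchy_step ::
    "('a::real_inner \<Rightarrow> 'a) \<Rightarrow> 'a \<Rightarrow> real \<Rightarrow> 'a \<Rightarrow> 'a \<Rightarrow> real" where
  "cauchy_step A b \<beta> x p =
     (inner (b - A x) (A p) - \<beta> * inner x p) / cauchy_step_denom A \<beta> p"

end

theory Submission imports Defs begin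

text \<open>Along the line \<open>x + t p\<close> the objective is a quadratic polynomial in \<open>t\<close> whose leading
  coefficient \<open>D\<close> is the denominator of the Cauchy step and whose linear coefficient is
  \<open>- 2 N\<close>, with \<open>N\<close> the numerator. At \<open>t = N / D\<close> its value is \<open>F(x) - N\<^sup>2 / D\<close>. Since
  \<open>\<beta> \<ge> 0\<close> gives \<open>D \<ge> 0\<close>, the objective does not increase, whatever the search direction.
  As \<open>F\<close> is nonnegative, the inequality between the values passes to their squares.\<close>

text \<open>This is the expansion of the two squared norms in the inner product. The residual
  \<open>b - A x\<close> is minus the vector \<open>A x - b\<close> in the objective, whence the sign of the linear term.\<close>

lemma lsq_objective_along_line:
  assumes "linear A"
  shows "lsq_objective A b \<beta> (x + t *\<^sub>R p) =
    lsq_objective A b \<beta> x - 2 * t * (inner (b - A x) (A p) - \<beta> * inner x p)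
      + t\<^sup>2 * cauchy_step_denom A \<beta> p"
proof -
  have "A (x + t *\<^sub>R p) - b = (A x - b) + t *\<^sub>R A p"
    using assms by (simp add: linear_add linear_scale)
  then show ?thesis
    unfolding lsq_objective_def cauchy_step_denom_def power2_norm_eq_inner
    by (simp add: inner_simps inner_commute algebra_simps power2_eq_square)
qed

lemma lsq_objective_cauchy_step:
  assumes "linear A" and "cauchy_step_denom A \<beta> p \<noteq> 0"
  shows "lsq_objective A b \<beta> (x + cauchy_step A b \<beta> x p *\<^sub>R p) =
    lsq_objective A b \<beta> x
      - (inner (b - A x) (A p) - \<beta> * inner x p)\<^sup>2 / cauchy_step_denom A \<beta> p"
  unfolding lsq_objective_along_line[OF assms(1)] cauchy_step_def
  using assms(2) by (simp add: field_simps power2_eq_square)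

theorem theorem6p1:
  fixes A :: "'a::{real_inner, banach} \<Rightarrow> 'a"
    and b :: 'a and \<beta> :: real
    and x p :: "nat \<Rightarrow> nat \<Rightarrow> 'a" and \<alpha> :: "nat \<Rightarrow> nat \<Rightarrow> real"
    and m j :: nat
  assumes "linear A"
    and "\<beta> \<ge> 0"
    and "\<And>i. 1 \<le> i \<Longrightarrow> i < m \<Longrightarrow> cauchy_step_denom A \<beta> (p i j) \<noteq> 0"
    and "\<And>i. 1 \<le> i \<Longrightarrow> i < m \<Longrightarrow> \<alpha> i j = cauchy_step A b \<beta> (x i j) (p i j)"
    and "\<And>i. 1 \<le> i \<Longrightarrow> i < m \<Longrightarrow> x (i + 1) j = x i j + \<alpha> i j *\<^sub>R p i j"
  shows "\<forall>i. 1 \<le> i \<and> i < m \<longrightarrow>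
    \<bar>lsq_objective A b \<beta> (x (i + 1) j)\<bar>\<^sup>2 \<le> \<bar>lsq_objective A b \<beta> (x i j)\<bar>\<^sup>2"
proof (intro allI impI, elim conjE)
  fix i assume i: "1 \<le> i" "i < m"
  have "0 \<le> cauchy_step_denom A \<beta> (p i j)"
    using assms(2) by (simp add: cauchy_step_denom_def)
  then have "lsq_objective A b \<beta> (x (i + 1) j) \<le> lsq_objective A b \<beta> (x i j)"
    unfolding assms(5)[OF i] assms(4)[OF i]
      lsq_objective_cauchy_step[OF assms(1) assms(3)[OF i]]
    by simp
  moreover have "0 \<le> lsq_objective A b \<beta> (x (i + 1) j)"
    using assms(2) by (simp add: lsq_objective_def)
  ultimately show "\<bar>lsq_objective A b \<beta> (x (i + 1) j)\<bar>\<^sup>2 \<le> \<bar>lsq_objective A b \<beta> (x i j)\<bar>\<^sup>2"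
    by (simp add: power_mono)
qed

end
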